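(* For every graph $\mathcal{G}$ there exists a minimal symplectic root system over $\mathbb{F}_2$ on $\mathcal{G}$, and it is unique up to isomorphism.
   Context: Graphs are finite, undirected, without loops or multiple edges; vector spaces are finite-dimensional. A symplectic vector space over a field $\Bbbk$ is a $\Bbbk$-vector space $V$ with a (possibly degenerate) bilinear form $\langle,\rangle:V\times V\to\Bbbk$ such that $\langle v,v\rangle=0$ for all $v\in V$. A symplectic root system $F=(f,V)$ over $\mathbb{F}_2$ on a graph $\mathcal{G}$ consists of a symplectic vector space $V$ over $\mathbb{F}_2$ and a map $f$ from the nodes of $\mathcal{G}$ to $V$ such that the image $f(\mathcal{G})$ generates $V$, and two nodes $\alpha,\beta$ are adjacent in $\mathcal{G}$ if and only if $\langle f(\alpha),f(\beta)\rangle\neq 0$. It is minimal if the family $\{f(\alpha)\}_{\alpha\in\mathcal{G}}$ is a basis of $V$. An isomorphism of symplectic root systems $(f,V)\to(g,W)$ on the same graph is a bijective linear map $\phi:V\to W$ with $\phi\circ f=g$. *)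

theory Defs
  imports
    "HOL-Library.Z2"
    "Graph_Theory.Digraph"
    "Jordan_Normal_Form.VS_Connect"
begin

abbreviation F2 :: "bit ring" where
  "F2 \<equiv> class_ring"

text \<open>The form may be degenerate; alternating means \<open>form v v = 0\<close>.\<close>

locale symplectic_space = vectorspace K V
  for K :: "('k, 'm) ring_scheme" and V :: "('k, 'v, 'n) module_scheme" +
  fixes form :: "'v \<Rightarrow> 'v \<Rightarrow> 'k"
  assumes finite_dimensional: "fin_dim"
    and form_closed: "\<lbrakk>u \<in> carrier V; v \<in> carrier V\<rbrakk> \<Longrightarrow> form u v \<in> carrier K"
    and form_add_left: "\<lbrakk>u \<in> carrier V; v \<in> carrier V; w \<in> carrier V\<rbrakk>
      \<Longrightarrow> form (u \<oplus>\<^bsub>V\<^esub> v) w = form u w \<oplus>\<^bsub>K\<^esub> form v w"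
    and form_add_right: "\<lbrakk>u \<in> carrier V; v \<in> carrier V; w \<in> carrier V\<rbrakk>
      \<Longrightarrow> form u (v \<oplus>\<^bsub>V\<^esub> w) = form u v \<oplus>\<^bsub>K\<^esub> form u w"
    and form_smult_left: "\<lbrakk>c \<in> carrier K; u \<in> carrier V; v \<in> carrier V\<rbrakk>
      \<Longrightarrow> form (c \<odot>\<^bsub>V\<^esub> u) v = c \<otimes>\<^bsub>K\<^esub> form u v"
    and form_smult_right: "\<lbrakk>c \<in> carrier K; u \<in> carrier V; v \<in> carrier V\<rbrakk>
      \<Longrightarrow> form u (c \<odot>\<^bsub>V\<^esub> v) = c \<otimes>\<^bsub>K\<^esub> form u v"
    and form_alternating: "v \<in> carrier V \<Longrightarrow> form v v = \<zero>\<^bsub>K\<^esub>"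

text \<open>
  The locale \<^locale>\<open>graph\<close> describes finite symmetric digraphs without loops or
  parallel arcs, so an undirected edge is a pair of opposite arcs and
  \<open>\<alpha> \<rightarrow>\<^bsub>G\<^esub> \<beta>\<close> is adjacency. The null graph is allowed.
  Only the values of \<open>f\<close> on \<open>verts G\<close> matter.
\<close>

locale symplectic_root_system = graph G + symplectic_space F2 V form
  for G :: "('a, 'b) pre_digraph"
    and V :: "(bit, 'v) module"
    and form :: "'v \<Rightarrow> 'v \<Rightarrow> bit" +
  fixes f :: "'a \<Rightarrow> 'v"
  assumes f_in_carrier: "\<alpha> \<in> verts G \<Longrightarrow> f \<alpha> \<in> carrier V"
    and f_generates: "gen_set (f ` verts G)"
    and adjacent_iff: "\<lbrakk>\<alpha> \<in> verts G; \<beta> \<in> verts G\<rbrakk>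
      \<Longrightarrow> \<alpha> \<rightarrow>\<^bsub>G\<^esub> \<beta> \<longleftrightarrow> form (f \<alpha>) (f \<beta>) \<noteq> \<zero>\<^bsub>F2\<^esub>"

text \<open>
  The \<^emph>\<open>family\<close> of all \<open>f \<alpha>\<close> has to be a basis, hence injectivity on the nodes
  in addition to the image being a basis.
\<close>

locale minimal_symplectic_root_system = symplectic_root_system +
  assumes f_inj: "inj_on f (verts G)"
    and f_basis: "basis (f ` verts G)"

text \<open>
  Preservation of the forms is not required: over \<^term>\<open>F2\<close> it is automatic, because
  the form is determined on the generators \<open>f \<alpha>\<close> by adjacency.
\<close>

definition root_system_isomorphism ::
  "('a, 'b) pre_digraph \<Rightarrow> (bit, 'v) module \<Rightarrow> ('a \<Rightarrow> 'v) \<Rightarrow> (bit, 'w) module \<Rightarrow> ('a \<Rightarrow> 'w)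
    \<Rightarrow> ('v \<Rightarrow> 'w) \<Rightarrow> bool"
  where "root_system_isomorphism G V f W g \<phi> \<longleftrightarrow>
    linear_map F2 V W \<phi> \<and>
    bij_betw \<phi> (carrier V) (carrier W) \<and>
    (\<forall>\<alpha> \<in> verts G. \<phi> (f \<alpha>) = g \<alpha>)"

end

theory Submission
  imports Defs
begin

text \<open>
  On the space \<open>\<bbbF>\<^sub>2\<^sup>\<G>\<close> of functions on the nodes, the adjacency matrix defines a bilinear form;
  it is alternating because the matrix is symmetric with zero diagonal and \<open>1 + 1 = 0\<close>. The
  standard basis vectors then form a minimal root system. For any minimal root system \<open>(f, V)\<close>,
  \<open>a \<mapsto> \<Sum> a(\<alpha>) f(\<alpha>)\<close> is a linear bijection from \<open>\<bbbF>\<^sub>2\<^sup>\<G>\<close> onto \<open>V\<close>, so two minimal root systems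
  are isomorphic through \<open>\<bbbF>\<^sub>2\<^sup>\<G>\<close>.
\<close>

section \<open>Bases given as families\<close>

text \<open>Coefficients are indexed by \<open>S\<close> rather than by the vectors themselves, so
  that families in different modules share the one coordinate space
  \<open>func_space S\<close>.\<close>

definition (in module) family_lincomb :: "('i \<Rightarrow> 'c) \<Rightarrow> 'i set \<Rightarrow> ('i \<Rightarrow> 'a) \<Rightarrow> 'c"
  where "family_lincomb f S a = (\<Oplus>\<^bsub>M\<^esub>x\<in>S. a x \<odot>\<^bsub>M\<^esub> f x)"

lemma (in module) family_lincomb_is_mod_hom:
  assumes fin: "finite S" and f: "f \<in> S \<rightarrow> carrier M"
  shows "mod_hom R (func_space S) M (family_lincomb f S)"
proof -
  interpret F: module R "func_space S" by (rule func_space_is_module)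
  show ?thesis
  proof (unfold_locales, unfold module_hom_def, safe)
    fix a assume "a \<in> carrier (func_space S)"
    then have a: "a \<in> S \<rightarrow> carrier R" by (auto simp: func_space_def)
    show "family_lincomb f S a \<in> carrier M"
      unfolding family_lincomb_def using a f by (intro M.finsum_closed) auto
  next
    fix a b assume "a \<in> carrier (func_space S)" "b \<in> carrier (func_space S)"
    then have ab: "a \<in> S \<rightarrow> carrier R" "b \<in> S \<rightarrow> carrier R" by (auto simp: func_space_def)
    have "family_lincomb f S (a \<oplus>\<^bsub>func_space S\<^esub> b) =
        (\<Oplus>\<^bsub>M\<^esub>x\<in>S. a x \<odot>\<^bsub>M\<^esub> f x \<oplus>\<^bsub>M\<^esub> b x \<odot>\<^bsub>M\<^esub> f x)"
      unfolding family_lincomb_def using ab f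
      by (intro M.finsum_cong') (auto simp: func_space_def smult_l_distr Pi_iff)
    also have "\<dots> = family_lincomb f S a \<oplus>\<^bsub>M\<^esub> family_lincomb f S b"
      unfolding family_lincomb_def using ab f by (intro M.finsum_addf) auto
    finally show "family_lincomb f S (a \<oplus>\<^bsub>func_space S\<^esub> b) =
      family_lincomb f S a \<oplus>\<^bsub>M\<^esub> family_lincomb f S b" .
  next
    fix c a assume c: "c \<in> carrier R" and "a \<in> carrier (func_space S)"
    then have a: "a \<in> S \<rightarrow> carrier R" by (auto simp: func_space_def)
    have "family_lincomb f S (c \<odot>\<^bsub>func_space S\<^esub> a) = (\<Oplus>\<^bsub>M\<^esub>x\<in>S. c \<odot>\<^bsub>M\<^esub> (a x \<odot>\<^bsub>M\<^esub> f x))"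
      unfolding family_lincomb_def using a c f
      by (intro M.finsum_cong') (auto simp: func_space_def smult_assoc1 Pi_iff)
    also have "\<dots> = c \<odot>\<^bsub>M\<^esub> family_lincomb f S a"
      unfolding family_lincomb_def using a c f
      by (intro finsum_smult_ldistr[symmetric] fin) auto
    finally show "family_lincomb f S (c \<odot>\<^bsub>func_space S\<^esub> a) = c \<odot>\<^bsub>M\<^esub> family_lincomb f S a" .
  qed
qed

lemma (in module) family_lincomb_unit:
  assumes "finite S" "f \<in> S \<rightarrow> carrier M" "x \<in> S"
  shows "family_lincomb f S (\<lambda>y\<in>S. if y = x then \<one> else \<zero>) = f x"
proof -
  have "family_lincomb f S (\<lambda>y\<in>S. if y = x then \<one> else \<zero>) =
      (\<Oplus>\<^bsub>M\<^esub>y\<in>S. if x = y then f y else \<zero>\<^bsub>M\<^esub>)"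
    unfolding family_lincomb_def using assms
    by (intro M.finsum_cong') (auto simp: Pi_iff)
  also have "\<dots> = f x"
    using assms by (intro M.finsum_singleton) auto
  finally show ?thesis .
qed

text \<open>Bridges \<open>basis_criterion\<close>, which speaks of unique coefficients for each
  vector, and bijectivity of the map from coefficients to vectors.\<close>

lemma bij_betw_iff_ex1:
  assumes "\<And>x. x \<in> A \<Longrightarrow> h x \<in> B"
  shows "bij_betw h A B \<longleftrightarrow> (\<forall>y\<in>B. \<exists>!x. x \<in> A \<and> h x = y)"
proof
  assume "bij_betw h A B"
  then show "\<forall>y\<in>B. \<exists>!x. x \<in> A \<and> h x = y"
    by (auto simp: bij_betw_def dest: inj_onD)
next
  assume *: "\<forall>y\<in>B. \<exists>!x. x \<in> A \<and> h x = y"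
  show "bij_betw h A B"
    unfolding bij_betw_def
  proof
    show "inj_on h A" by (rule inj_onI) (metis * assms)
    show "h ` A = B" using * assms by fast
  qed
qed

lemma (in vectorspace) basis_family_iff:
  assumes fin: "finite S" and f: "f \<in> S \<rightarrow> carrier V" and inj: "inj_on f S"
  shows "basis (f ` S) \<longleftrightarrow>
    bij_betw (family_lincomb f S) (carrier (func_space S)) (carrier V)"
proof -
  \<comment> \<open>\<open>r\<close> pulls coefficients back along \<open>f\<close>; its inverse
    looks up the index of a vector with \<open>inv_into S f\<close>.\<close>
  define r where "r a = (\<lambda>x\<in>S. a (f x))" for a :: "'c \<Rightarrow> 'a"
  have r: "bij_betw r (f ` S \<rightarrow>\<^sub>E carrier K) (S \<rightarrow>\<^sub>E carrier K)"
  proof (rule bij_betw_byWitness[where f' = "\<lambda>a. \<lambda>v\<in>f ` S. a (inv_into S f v)"])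
    show "\<forall>a\<in>f ` S \<rightarrow>\<^sub>E carrier K. (\<lambda>v\<in>f ` S. r a (inv_into S f v)) = a"
      by (auto simp: r_def fun_eq_iff restrict_def PiE_def extensional_def f_inv_into_f inv_into_into)
    show "\<forall>a\<in>S \<rightarrow>\<^sub>E carrier K. r (\<lambda>v\<in>f ` S. a (inv_into S f v)) = a"
      using inj by (auto simp: r_def fun_eq_iff restrict_def PiE_def extensional_def)
    show "r ` (f ` S \<rightarrow>\<^sub>E carrier K) \<subseteq> S \<rightarrow>\<^sub>E carrier K"
      by (auto simp: r_def)
    show "(\<lambda>a. \<lambda>v\<in>f ` S. a (inv_into S f v)) ` (S \<rightarrow>\<^sub>E carrier K) \<subseteq> f ` S \<rightarrow>\<^sub>E carrier K"
      using inj by auto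
  qed
  have lincomb: "lincomb a (f ` S) = (family_lincomb f S \<circ> r) a"
    if "a \<in> f ` S \<rightarrow>\<^sub>E carrier K" for a
  proof -
    have a: "a \<in> f ` S \<rightarrow> carrier K" using that by auto
    have "lincomb a (f ` S) = (\<Oplus>\<^bsub>V\<^esub>x\<in>S. a (f x) \<odot>\<^bsub>V\<^esub> f x)"
      unfolding lincomb_def using a f inj by (intro M.finsum_reindex) auto
    also have "\<dots> = (family_lincomb f S \<circ> r) a"
      unfolding family_lincomb_def comp_def using a f
      by (intro M.finsum_cong') (auto simp: r_def Pi_iff)
    finally show ?thesis .
  qed
  have sub: "f ` S \<subseteq> carrier V" using f by auto
  have closed: "lincomb a (f ` S) \<in> carrier V" if "a \<in> f ` S \<rightarrow>\<^sub>E carrier K" for a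
    using that sub by (intro lincomb_closed) auto
  have "basis (f ` S) \<longleftrightarrow>
      (\<forall>v\<in>carrier V. \<exists>!a. a \<in> f ` S \<rightarrow>\<^sub>E carrier K \<and> lincomb a (f ` S) = v)"
    using basis_criterion[of "f ` S"] fin sub by (simp add: Ball_def)
  also have "\<dots> \<longleftrightarrow>
      bij_betw (\<lambda>a. lincomb a (f ` S)) (f ` S \<rightarrow>\<^sub>E carrier K) (carrier V)"
    using closed by (rule bij_betw_iff_ex1[symmetric])
  also have "\<dots> \<longleftrightarrow> bij_betw (family_lincomb f S \<circ> r) (f ` S \<rightarrow>\<^sub>E carrier K) (carrier V)"
    by (intro bij_betw_cong lincomb)
  also have "\<dots> \<longleftrightarrow> bij_betw (family_lincomb f S) (S \<rightarrow>\<^sub>E carrier K) (carrier V)"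
    by (rule bij_betw_comp_iff[OF r, symmetric])
  finally show ?thesis by (simp add: func_space_def)
qed

section \<open>Linear isomorphisms\<close>

lemma linear_map_comp:
  assumes "linear_map K U V T" "linear_map K V W T'"
  shows "linear_map K U W (T' \<circ> T)"
proof -
  interpret T: linear_map K U V T by fact
  interpret T': linear_map K V W T' by fact
  show ?thesis
    by unfold_locales (auto simp: module_hom_def)
qed

lemma linear_map_inv_into:
  assumes "linear_map K U V T" and bij: "bij_betw T (carrier U) (carrier V)"
  shows "linear_map K V U (inv_into (carrier U) T)"
proof -
  interpret T: linear_map K U V T by fact
  let ?I = "inv_into (carrier U) T"
  have I: "?I v \<in> carrier U" "T (?I v) = v" if "v \<in> carrier V" for v
    using that bij by (auto simp: bij_betw_def inv_into_into f_inv_into_f)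
  have I_eq: "?I (T u) = u" if "u \<in> carrier U" for u
    using that bij by (simp add: bij_betw_def)
  show ?thesis
  proof (unfold_locales, unfold module_hom_def, safe)
    fix v assume "v \<in> carrier V" then show "?I v \<in> carrier U" by (rule I)
  next
    \<comment> \<open>\<open>I_eq\<close> is instantiated at the right-hand side: by linearity
      \<open>T\<close> sends it to the sum of \<open>v\<close> and \<open>w\<close>, so
      \<open>?I\<close> must send that sum back to it.\<close>
    fix v w assume "v \<in> carrier V" "w \<in> carrier V"
    then show "?I (v \<oplus>\<^bsub>V\<^esub> w) = ?I v \<oplus>\<^bsub>U\<^esub> ?I w"
      using I_eq[of "?I v \<oplus>\<^bsub>U\<^esub> ?I w"] by (simp add: I)
  next
    fix c v assume "c \<in> carrier K" "v \<in> carrier V"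
    then show "?I (c \<odot>\<^bsub>V\<^esub> v) = c \<odot>\<^bsub>U\<^esub> ?I v"
      using I_eq[of "c \<odot>\<^bsub>U\<^esub> ?I v"] by (simp add: I)
  qed
qed

text \<open>Taking coordinates with respect to \<open>f\<close> and then combining the vectors
  \<open>g x\<close> with these coordinates gives the isomorphism.\<close>

lemma basis_families_linear_isomorphism:
  assumes V: "vectorspace K V" and W: "vectorspace K W" and fin: "finite S"
    and f: "f \<in> S \<rightarrow> carrier V" "inj_on f S" "vectorspace.basis K V (f ` S)"
    and g: "g \<in> S \<rightarrow> carrier W" "inj_on g S" "vectorspace.basis K W (g ` S)"
  shows "\<exists>T. linear_map K V W T \<and> bij_betw T (carrier V) (carrier W) \<and> (\<forall>x\<in>S. T (f x) = g x)"
proof -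
  interpret V: vectorspace K V by fact
  interpret W: vectorspace K W by fact
  let ?F = "V.func_space S"
  let ?P = "V.family_lincomb f S" and ?Q = "W.family_lincomb g S"
  interpret F: vectorspace K ?F by (rule V.func_space_is_vs)
  interpret P: mod_hom K ?F V ?P by (rule V.family_lincomb_is_mod_hom[OF fin f(1)])
  interpret Q: mod_hom K ?F W ?Q by (rule W.family_lincomb_is_mod_hom[OF fin g(1)])
  have P: "linear_map K ?F V ?P" and Q: "linear_map K ?F W ?Q" by unfold_locales
  have bij_P: "bij_betw ?P (carrier ?F) (carrier V)"
    using V.basis_family_iff[OF fin f(1,2)] f(3) by simp
  have bij_Q: "bij_betw ?Q (carrier ?F) (carrier W)"
    using W.basis_family_iff[OF fin g(1,2)] g(3) by simp
  show ?thesis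
  proof (intro exI conjI ballI)
    show "linear_map K V W (?Q \<circ> inv_into (carrier ?F) ?P)"
      by (rule linear_map_comp[OF linear_map_inv_into[OF P bij_P] Q])
    show "bij_betw (?Q \<circ> inv_into (carrier ?F) ?P) (carrier V) (carrier W)"
      by (rule bij_betw_trans[OF bij_betw_inv_into[OF bij_P] bij_Q])
    fix x assume x: "x \<in> S"
    \<comment> \<open>The coordinate vector of \<open>f x\<close>: \<open>?P\<close> maps it to
      \<open>f x\<close> and \<open>?Q\<close> maps it to \<open>g x\<close>.\<close>
    let ?e = "\<lambda>y\<in>S. if y = x then \<one>\<^bsub>K\<^esub> else \<zero>\<^bsub>K\<^esub>"
    have e: "?e \<in> carrier ?F" by (simp add: V.func_space_def)
    have "inv_into (carrier ?F) ?P (f x) = ?e"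
      using bij_P e V.family_lincomb_unit[OF fin f(1) x]
      by (metis bij_betw_imp_inj_on inv_into_f_f)
    then show "(?Q \<circ> inv_into (carrier ?F) ?P) (f x) = g x"
      using W.family_lincomb_unit[OF fin g(1) x] by simp
  qed
qed

section \<open>The standard basis of a function space\<close>

text \<open>Evaluation at a point of \<open>S\<close> is additive, so it passes through the sum by
  induction on \<open>A\<close>.\<close>

lemma (in cring) finsum_func_space_apply:
  assumes "finite A" "F \<in> A \<rightarrow> carrier (func_space S)" "y \<in> S"
  shows "(\<Oplus>\<^bsub>func_space S\<^esub>x\<in>A. F x) y = (\<Oplus>x\<in>A. F x y)"
proof -
  interpret FS: module R "func_space S" by (rule func_space_is_module)
  show ?thesis
    using assms(1,2)
  proof (induction A)
    case empty
    have "\<zero>\<^bsub>func_space S\<^esub> y = \<zero>" using assms(3) by (simp add: func_space_def)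
    then show ?case by simp
  next
    case (insert z A)
    have "F x y \<in> carrier R" if "x \<in> insert z A" for x
      using that insert.prems assms(3) by (auto simp: func_space_def)
    moreover have "(\<Oplus>\<^bsub>func_space S\<^esub>x\<in>insert z A. F x) =
        F z \<oplus>\<^bsub>func_space S\<^esub> (\<Oplus>\<^bsub>func_space S\<^esub>x\<in>A. F x)"
      using insert by (intro FS.M.finsum_insert) auto
    moreover have "(F z \<oplus>\<^bsub>func_space S\<^esub> G) y = F z y \<oplus> G y" for G
      using assms(3) by (simp add: func_space_def)
    ultimately show ?case
      using insert by (simp add: Pi_iff)
  qed
qed

definition (in ring) unit_fun :: "'z set \<Rightarrow> 'z \<Rightarrow> 'z \<Rightarrow> 'a"
  where "unit_fun S x = (\<lambda>y\<in>S. if y = x then \<one> else \<zero>)"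

lemma (in ring) unit_fun_in_func_space: "unit_fun S x \<in> carrier (func_space S)"
  by (simp add: unit_fun_def func_space_def)

lemma (in field) inj_on_unit_fun: "inj_on (unit_fun S) S"
proof (rule inj_onI)
  fix x y assume x: "x \<in> S" and "unit_fun S x = unit_fun S y"
  then have "unit_fun S x x = unit_fun S y x" by simp
  then show "x = y"
    using x by (simp add: unit_fun_def split: if_splits)
qed

lemma (in field) vectorspace_func_space: "vectorspace R (func_space S)"
  by (simp add: vectorspace_def func_space_is_module field_axioms)

text \<open>Every function is the combination of the unit functions with its own values as
  coefficients. Thus \<open>family_lincomb\<close> is the identity here, in particular
  bijective.\<close>

lemma (in field) basis_unit_fun:
  assumes fin: "finite S"
  shows "vectorspace.basis R (func_space S) (unit_fun S ` S)"
proof -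
  interpret FS: vectorspace R "func_space S" by (rule vectorspace_func_space)
  have e: "unit_fun S \<in> S \<rightarrow> carrier (func_space S)"
    by (simp add: unit_fun_in_func_space)
  have "FS.family_lincomb (unit_fun S) S a = a" if a: "a \<in> carrier (func_space S)" for a
  proof
    fix y
    have S: "b \<in> carrier (func_space S) \<longleftrightarrow> b \<in> S \<rightarrow>\<^sub>E carrier R" for b
      by (simp add: func_space_def)
    have mem: "FS.family_lincomb (unit_fun S) S a \<in> carrier (func_space S)"
      using mod_hom.f_im[OF FS.family_lincomb_is_mod_hom[OF fin e] a] .
    have a_in: "a \<in> S \<rightarrow> carrier R"
      using a by (auto simp: S)
    show "FS.family_lincomb (unit_fun S) S a y = a y"
    proof (cases "y \<in> S")
      case True
      have "FS.family_lincomb (unit_fun S) S a y =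
          (\<Oplus>x\<in>S. (a x \<odot>\<^bsub>func_space S\<^esub> unit_fun S x) y)"
        unfolding FS.family_lincomb_def
        using e a_in by (intro finsum_func_space_apply fin True) auto
      also have "\<dots> = (\<Oplus>x\<in>S. if y = x then a x else \<zero>)"
        using True a_in
        by (intro finsum_cong') (auto simp: func_space_def unit_fun_def Pi_iff)
      also have "\<dots> = a y" using True fin a_in by (rule finsum_singleton)
      finally show ?thesis .
    next
      \<comment> \<open>Off \<open>S\<close> both sides are \<open>undefined\<close>, since elements
        of \<open>func_space S\<close> are extensional.\<close>
      case False
      then show ?thesis using mem a by (auto simp: S PiE_def extensional_def)
    qed
  qed
  then have "bij_betw (FS.family_lincomb (unit_fun S) S)
      (carrier (func_space S)) (carrier (func_space S))"
    using bij_betw_cong[of "carrier (func_space S)" "FS.family_lincomb (unit_fun S) S" id]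
      bij_betw_id by auto
  then show "FS.basis (unit_fun S ` S)"
    using FS.basis_family_iff[OF fin e inj_on_unit_fun] by simp
qed

section \<open>The adjacency form\<close>

text \<open>These rules would rewrite the operations of \<^term>\<open>F2\<close> to bitwise ones.\<close>

declare add_bit_eq_xor [simp del] mult_bit_eq_and [simp del]

text \<open>In characteristic 2 the entries at \<open>(x, y)\<close> and \<open>(y, x)\<close>
  cancel, and the diagonal contributes nothing.\<close>

lemma sum_symmetric_bit_eq_0:
  fixes m :: "'a \<Rightarrow> 'a \<Rightarrow> bit"
  assumes "finite S" and "\<And>x y. m x y = m y x" and "\<And>x. m x x = 0"
  shows "(\<Sum>x\<in>S. \<Sum>y\<in>S. m x y) = 0"
  using assms(1)
proof (induction S)
  case (insert z S)
  \<comment> \<open>Adjoining \<open>z\<close> adds a new column and a new row; they have equal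
    sums, and \<open>s + s = 0\<close> removes both.\<close>
  have "(\<Sum>x\<in>S. m x z) = (\<Sum>y\<in>S. m z y)"
    by (intro sum.cong refl assms(2))
  moreover have "s + s = 0" for s :: bit
    by (cases s) simp_all
  ultimately show ?case
    using insert by (simp add: sum.distrib assms(3))
qed simp

abbreviation coord_space :: "'a set \<Rightarrow> (bit, 'a \<Rightarrow> bit) module"
  where "coord_space S \<equiv> ring.func_space F2 S"

abbreviation unit_coord :: "'a set \<Rightarrow> 'a \<Rightarrow> 'a \<Rightarrow> bit"
  where "unit_coord S \<equiv> ring.unit_fun F2 S"

lemma coord_space_simps:
  "u \<oplus>\<^bsub>coord_space S\<^esub> v = (\<lambda>x\<in>S. u x + v x)"
  "c \<odot>\<^bsub>coord_space S\<^esub> v = (\<lambda>x\<in>S. c * v x)"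
  by (simp_all add: class_ring.func_space_def)

text \<open>The bilinear form of the adjacency matrix. Only values at nodes enter, so restricting
  functions to \<open>verts G\<close> does not change it.\<close>

definition adjacency_form :: "('a, 'b) pre_digraph \<Rightarrow> ('a \<Rightarrow> bit) \<Rightarrow> ('a \<Rightarrow> bit) \<Rightarrow> bit"
  where "adjacency_form G u v =
    (\<Sum>\<alpha>\<in>verts G. \<Sum>\<beta>\<in>verts G. u \<alpha> * v \<beta> * of_bool (\<alpha> \<rightarrow>\<^bsub>G\<^esub> \<beta>))"

lemma adjacency_form_add_left:
  "adjacency_form G (u \<oplus>\<^bsub>coord_space (verts G)\<^esub> v) w = adjacency_form G u w + adjacency_form G v w"
  unfolding adjacency_form_def coord_space_simps sum.distrib[symmetric]
  by (intro sum.cong refl) (simp add: distrib_right)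

lemma adjacency_form_add_right:
  "adjacency_form G u (v \<oplus>\<^bsub>coord_space (verts G)\<^esub> w) = adjacency_form G u v + adjacency_form G u w"
  unfolding adjacency_form_def coord_space_simps sum.distrib[symmetric]
  by (intro sum.cong refl) (simp add: distrib_right distrib_left)

lemma adjacency_form_smult_left:
  "adjacency_form G (c \<odot>\<^bsub>coord_space (verts G)\<^esub> u) v = c * adjacency_form G u v"
  unfolding adjacency_form_def coord_space_simps sum_distrib_left
  by (intro sum.cong refl) (simp add: mult.assoc)

lemma adjacency_form_smult_right:
  "adjacency_form G u (c \<odot>\<^bsub>coord_space (verts G)\<^esub> v) = c * adjacency_form G u v"
  unfolding adjacency_form_def coord_space_simps sum_distrib_left
  by (intro sum.cong refl) (simp add: mult.assoc mult.left_commute)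

text \<open>The summands form a symmetric matrix because arcs come in opposite pairs, and its
  diagonal vanishes because there are no loops.\<close>

lemma (in graph) adjacency_form_alternating: "adjacency_form G v v = 0"
  unfolding adjacency_form_def
proof (rule sum_symmetric_bit_eq_0)
  show "v x * v y * of_bool (x \<rightarrow>\<^bsub>G\<^esub> y) = v y * v x * of_bool (y \<rightarrow>\<^bsub>G\<^esub> x)" for x y
    using arcs_ends_symmetric[OF sym_arcs] by (auto simp: mult.commute)
  show "v x * v x * of_bool (x \<rightarrow>\<^bsub>G\<^esub> x) = 0" for x
    using adj_not_same by auto
qed (rule finite_verts)

lemma adjacency_form_unit_coord:
  assumes "finite (verts G)" "\<alpha> \<in> verts G" "\<beta> \<in> verts G"
  shows "adjacency_form G (unit_coord (verts G) \<alpha>) (unit_coord (verts G) \<beta>) =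
    of_bool (\<alpha> \<rightarrow>\<^bsub>G\<^esub> \<beta>)"
proof -
  \<comment> \<open>Nested conditionals let both sums collapse to the single entry at
    \<open>\<alpha>\<close>, \<open>\<beta>\<close>.\<close>
  have "adjacency_form G (unit_coord (verts G) \<alpha>) (unit_coord (verts G) \<beta>) =
      (\<Sum>x\<in>verts G. if x = \<alpha> then \<Sum>y\<in>verts G. if y = \<beta> then of_bool (\<alpha> \<rightarrow>\<^bsub>G\<^esub> \<beta>) else 0 else 0)"
    unfolding adjacency_form_def class_ring.unit_fun_def
    by (intro sum.cong refl) (auto intro!: sum.cong)
  then show ?thesis using assms by simp
qed

lemma (in graph) minimal_symplectic_root_system_coord_space:
  "minimal_symplectic_root_system G (coord_space (verts G)) (adjacency_form G) (unit_coord (verts G))"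
proof -
  let ?V = "coord_space (verts G)"
  let ?e = "unit_coord (verts G)"
  interpret vectorspace F2 ?V by (rule field.vectorspace_func_space[OF class_field])
  have e: "?e \<alpha> \<in> carrier ?V" for \<alpha>
    by (rule class_ring.unit_fun_in_func_space)
  have basis: "basis (?e ` verts G)"
    by (rule field.basis_unit_fun[OF class_field finite_verts])
  then have gen: "gen_set (?e ` verts G)"
    by (simp only: basis_def)
  \<comment> \<open>The finitely many unit vectors, one per node, span the space.\<close>
  have fin: "fin_dim"
    unfolding fin_dim_def using gen e by (intro exI[of _ "?e ` verts G"] conjI) auto
  show ?thesis
  proof (unfold_locales, goal_cases)
    case 1 show ?case by (rule fin)
  next
    case 2 show ?case by simp
  next
    case 3 show ?case by (simp add: adjacency_form_add_left)
  next
    case 4 show ?case by (simp add: adjacency_form_add_right)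
  next
    case 5 show ?case by (simp add: adjacency_form_smult_left)
  next
    case 6 show ?case by (simp add: adjacency_form_smult_right)
  next
    case 7 show ?case by (simp add: adjacency_form_alternating)
  next
    case 8 show ?case by (rule e)
  next
    case 9 show ?case by (rule gen)
  next
    case (10 \<alpha> \<beta>)
    then show ?case by (simp add: adjacency_form_unit_coord)
  next
    case 11 show ?case by (rule field.inj_on_unit_fun[OF class_field])
  next
    case 12 show ?case by (rule basis)
  qed
qed

text \<open>Types cannot be quantified inside a HOL formula: existence names functions on the nodes
  as the type of vectors, while uniqueness keeps \<open>'v\<close> and \<open>'w\<close> as free
  type variables.\<close>

theorem lemma3p10:
  fixes G :: "('a, 'b) pre_digraph"
  assumes "graph G"
  shows "(\<exists>(V :: (bit, 'a \<Rightarrow> bit) module) form f. minimal_symplectic_root_system G V form f) \<and>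
    (\<forall>(V :: (bit, 'v) module) form f (W :: (bit, 'w) module) form' g.
      minimal_symplectic_root_system G V form f \<longrightarrow>
      minimal_symplectic_root_system G W form' g \<longrightarrow>
      (\<exists>\<phi>. root_system_isomorphism G V f W g \<phi>))"
proof (intro conjI allI impI)
  show "\<exists>(V :: (bit, 'a \<Rightarrow> bit) module) form f. minimal_symplectic_root_system G V form f"
    using graph.minimal_symplectic_root_system_coord_space[OF assms] by blast
next
  fix V :: "(bit, 'v) module" and form f and W :: "(bit, 'w) module" and form' g
  assume "minimal_symplectic_root_system G V form f" "minimal_symplectic_root_system G W form' g"
  then interpret V: minimal_symplectic_root_system G V form f +
    W: minimal_symplectic_root_system G W form' g .
  show "\<exists>\<phi>. root_system_isomorphism G V f W g \<phi>"
    unfolding root_system_isomorphism_def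
  \<comment> \<open>Both families are bases indexed by the same set \<open>verts G\<close>, so
    matching them node by node gives the isomorphism.\<close>
  proof (rule basis_families_linear_isomorphism)
    show "f \<in> verts G \<rightarrow> carrier V" using V.f_in_carrier by blast
    show "g \<in> verts G \<rightarrow> carrier W" using W.f_in_carrier by blast
  qed (rule V.vectorspace_axioms W.vectorspace_axioms V.finite_verts V.f_inj W.f_inj
      V.f_basis W.f_basis)+
qed

end
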